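(* Let $k$ be a positive integer, let $p$ be a prime with $p\equiv 3\pmod 4$, and let $\delta$ be a non-negative integer such that $p$ divides $4\delta+3$. Then for all integers $n\ge 0$, $$pod_3\left(p^{k+1}n+p\delta+\frac{3p-1}{4}\right)\equiv pod_3\left(p^{k-1}n+\frac{4\delta+3-p}{4p}\right)\pmod 3.$$
   Context: $pod_3(n)$ denotes the number of partitions of $n$ in which no part is divisible by $3$, the odd parts are distinct, and the even parts are unrestricted (with $pod_3(0)=1$); equivalently $\sum_{n\ge0}pod_3(n)q^n=\psi(-q^3)/\psi(-q)$, where $\psi(q)=\sum_{n\ge0}q^{n(n+1)/2}$. *)

theory Defs
  imports "HOL-Library.Multiset" "HOL-Number_Theory.Number_Theory"
begin

definition pod3_partitions :: "nat \<Rightarrow> nat multiset set" where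
  "pod3_partitions n =
     {P. sum_mset P = n \<and> (\<forall>x \<in># P. 0 < x) \<and>
         (\<forall>x \<in># P. \<not> 3 dvd x) \<and>
         (\<forall>x \<in># P. odd x \<longrightarrow> count P x = 1)}"

definition pod3 :: "nat \<Rightarrow> nat" where
  "pod3 n = card (pod3_partitions n)"

lemma finite_pod3_partitions: "finite (pod3_partitions n)"
proof (rule finite_subset)
  show "finite (mset ` {xs. set xs \<subseteq> {..n} \<and> length xs \<le> n})"
    by (intro finite_imageI finite_lists_length_le) simp
  show "pod3_partitions n \<subseteq> mset ` {xs. set xs \<subseteq> {..n} \<and> length xs \<le> n}"
  proof
    fix P assume "P \<in> pod3_partitions n"
    then have sum: "sum_mset P = n" and pos: "\<forall>x \<in># P. 0 < x"
      by (auto simp: pod3_partitions_def)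
    have size: "size P \<le> n"
      using pos unfolding sum[symmetric] by (induction P) (auto simp: Suc_le_eq)
    obtain xs where xs: "mset xs = P" using ex_mset by blast
    have "set xs \<subseteq> {..n}"
      using xs sum by (auto simp: sum_mset_sum_list intro: member_le_sum_list)
    moreover have "length xs \<le> n" using xs size by auto
    ultimately show "P \<in> mset ` {xs. set xs \<subseteq> {..n} \<and> length xs \<le> n}"
      using xs by blast
  qed
qed

lemma pod3_0: "pod3 0 = 1"
proof -
  have "pod3_partitions 0 = {{#}}"
    by (auto simp: pod3_partitions_def) (metis less_irrefl multiset_nonemptyE)
  then show ?thesis by (simp add: pod3_def)
qed

end

theory Submission
  imports Defs "HOL-Computational_Algebra.Formal_Power_Series" "HOL-Library.Numeral_Type"
begin

text \<open>
  Let \<open>\<psi>(q) = \<Sum> q\<^bsup>s(s+1)/2\<^esup>\<close>. By Gauss, \<open>\<psi>(-q) = \<Prod> (1 - q\<^bsup>2i\<^esup>) / (1 + q\<^bsup>2i-1\<^esup>)\<close>,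
  and the generating function of \<open>pod3\<close> is \<open>\<psi>(-q\<^sup>3) / \<psi>(-q)\<close>, which is congruent to \<open>\<psi>(-q)\<^sup>2\<close>
  modulo 3. Hence \<open>pod3 n\<close> is congruent to \<open>(-1)\<^sup>n\<close> times the number of pairs of odd positive
  integers with \<open>x\<^sup>2 + y\<^sup>2 = 8n + 2\<close>. A prime \<open>p \<equiv> 3 (mod 4)\<close> dividing \<open>x\<^sup>2 + y\<^sup>2\<close> divides
  \<open>x\<close> and \<open>y\<close>, so this number does not change when \<open>4n + 1\<close> is divided by \<open>p\<^sup>2\<close>; nor does the
  parity of \<open>n\<close>, because \<open>p\<^sup>2 \<equiv> 1 (mod 8)\<close>. Gauss's product is obtained from a finite identity of
  Shanks, so that all infinite products can be replaced by truncations.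
\<close>

section \<open>A finite form of Gauss's triangular number identity\<close>

definition tri :: "nat \<Rightarrow> nat" where
  "tri s = s * (s + 1) div 2"

lemma two_tri: "2 * tri s = s * (s + 1)"
  unfolding tri_def by simp

lemma tri_ge: "s \<le> tri s"
  using two_tri[of s] by (cases s) auto

lemma tri_double_Suc:
  "tri (2 * n + 1) = (n + 1) * (2 * n + 1)" "tri (2 * n + 2) = (n + 1) * (2 * n + 3)"
proof -
  have "2 * tri (2 * n + 1) = 2 * ((n + 1) * (2 * n + 1))"
    unfolding two_tri by (simp add: algebra_simps)
  then show "tri (2 * n + 1) = (n + 1) * (2 * n + 1)" by simp
  have "2 * tri (2 * n + 2) = 2 * ((n + 1) * (2 * n + 3))"
    unfolding two_tri by (simp add: algebra_simps)
  then show "tri (2 * n + 2) = (n + 1) * (2 * n + 3)" by simp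
qed

text \<open>For \<open>m \<le> n\<close> this is the quotient of q-shifted factorials (x^2;x^2)_n /
  (x^2;x^2)_m, written as a product so that no division occurs in the ring.\<close>

definition euler_prod :: "'a::comm_ring_1 \<Rightarrow> nat \<Rightarrow> nat \<Rightarrow> 'a" where
  "euler_prod x m n = (\<Prod>i\<in>{m<..n}. 1 - x ^ (2 * i))"

definition odd_prod :: "'a::comm_ring_1 \<Rightarrow> nat \<Rightarrow> 'a" where
  "odd_prod x n = (\<Prod>i\<in>{0<..n}. 1 - x ^ (2 * i - 1))"

lemma odd_prod_Suc: "odd_prod x (Suc n) = odd_prod x n * (1 - x ^ (2 * n + 1))"
proof -
  have "{0<..Suc n} = insert (Suc n) {0<..n}" by auto
  then show ?thesis by (simp add: odd_prod_def mult.commute)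
qed

lemma odd_prod_0: "odd_prod x 0 = 1"
  by (simp add: odd_prod_def)

lemma euler_prod_same: "euler_prod x n n = 1"
  by (simp add: euler_prod_def)

lemma euler_prod_Suc_right:
  assumes "m \<le> n"
  shows "euler_prod x m (Suc n) = euler_prod x m n * (1 - x ^ (2 * n + 2))"
proof -
  have "{m<..Suc n} = insert (Suc n) {m<..n}" using assms by auto
  then show ?thesis by (simp add: euler_prod_def mult.commute)
qed

lemma euler_prod_left:
  assumes "m < n"
  shows "euler_prod x m n = (1 - x ^ (2 * m + 2)) * euler_prod x (Suc m) n"
proof -
  have "{m<..n} = insert (Suc m) {Suc m<..n}" using assms by auto
  then show ?thesis by (simp add: euler_prod_def)
qed

text \<open>The right side vanishes at \<open>m = 0\<close>, and each summand is its increment from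
  \<open>s\<close> to \<open>s + 1\<close>. The bracket compares consecutive Shanks sums: passing
  from \<open>n\<close> to \<open>n + 1\<close> multiplies the term \<open>s\<close> by
  \<open>(1 - x ^ (2 * n + 2)) * x ^ (2 * s)\<close>, while \<open>odd_prod\<close> gains the factor
  \<open>1 - x ^ (2 * n + 1)\<close>.\<close>

lemma shanks_telescope:
  fixes x :: "'a::comm_ring_1"
  assumes "m \<le> n"
  shows "(\<Sum>s<m. odd_prod x s * euler_prod x s n * x ^ (s * (2 * n + 1)) *
              ((1 - x ^ (2 * n + 2)) * x ^ (2 * s) - (1 - x ^ (2 * n + 1))))
         = odd_prod x m * euler_prod x m n * x ^ (m * (2 * n + 1)) * (1 - x ^ (2 * m))"
    (is "(\<Sum>s<m. ?t s) = _")
  using assms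
proof (induction m)
  case 0
  then show ?case by simp
next
  case (Suc m)
  define c where "c = odd_prod x m * x ^ (m * (2 * n + 1))"
  define e where "e = euler_prod x (Suc m) n"
  define u v where "u = x ^ (2 * n + 1)" and "v = x ^ (2 * m)"
  have e: "euler_prod x m n = (1 - x * x * v) * e"
    using Suc.prems by (simp add: euler_prod_left e_def v_def mult.assoc)
  have "(\<Sum>s<Suc m. ?t s) =
      c * ((1 - x * x * v) * e) * (1 - v) + c * ((1 - x * x * v) * e) * ((1 - x * u) * v - (1 - u))"
    using Suc by (simp add: c_def u_def v_def e ac_simps)
  \<comment> \<open>Apart from the common factor, \<open>(1 - v) + (1 - x * u) * v - (1 - u)\<close>
    equals \<open>u * (1 - x * v)\<close>, and \<open>1 - x * v\<close> is the next factor of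
    \<open>odd_prod\<close>.\<close>
  also have "\<dots> = c * (1 - x * v) * e * u * (1 - x * x * v)"
    by (simp add: algebra_simps)
  also have "\<dots> = odd_prod x (Suc m) * euler_prod x (Suc m) n * x ^ (Suc m * (2 * n + 1)) *
      (1 - x ^ (2 * Suc m))"
    by (simp add: c_def u_def v_def e_def odd_prod_Suc power_add ac_simps)
  finally show ?case .
qed

text \<open>Induction on \<open>n\<close>: subtracting \<open>1 - x ^ (2 * n + 1)\<close> times the
  old sum from the new one leaves a telescoping part, which yields the exponent
  \<open>tri (2 * n + 1)\<close>, and the new index \<open>s = n + 1\<close>, which yields
  \<open>tri (2 * n + 2)\<close>.\<close>

lemma shanks_identity:
  fixes x :: "'a::comm_ring_1"
  shows "(\<Sum>s\<le>n. odd_prod x s * euler_prod x s n * x ^ (s * (2 * n + 1)))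
         = odd_prod x n * (\<Sum>s\<le>2 * n. x ^ tri s)"
proof (induction n)
  case 0
  then show ?case by (simp add: tri_def odd_prod_0 euler_prod_same)
next
  case (Suc n)
  let ?t = "\<lambda>s. odd_prod x s * euler_prod x s n * x ^ (s * (2 * n + 1))"
  let ?d = "\<lambda>s. (1 - x ^ (2 * n + 2)) * x ^ (2 * s) - (1 - x ^ (2 * n + 1))"
  have diff: "(\<Sum>s\<le>n. ?t s * ?d s) = odd_prod x (Suc n) * x ^ tri (2 * n + 1)"
  proof -
    \<comment> \<open>Telescoping covers only \<open>s < n\<close>: at \<open>s = n\<close> the
      product \<open>euler_prod x n n\<close> is empty and has no factor left to split off, so this
      term is added separately.\<close>
    have "(\<Sum>s\<le>n. ?t s * ?d s) = (\<Sum>s<n. ?t s * ?d s) + ?t n * ?d n"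
      by (simp add: lessThan_Suc_atMost[symmetric])
    also have "\<dots> = odd_prod x n * x ^ (n * (2 * n + 1)) * (1 - x ^ (2 * n) + ?d n)"
      unfolding shanks_telescope[OF order.refl] by (simp add: euler_prod_same algebra_simps)
    also have "1 - x ^ (2 * n) + ?d n = x ^ (2 * n + 1) * (1 - x ^ (2 * n + 1))"
      by (simp add: algebra_simps power_add)
    finally have "(\<Sum>s\<le>n. ?t s * ?d s)
        = odd_prod x (Suc n) * (x ^ (n * (2 * n + 1)) * x ^ (2 * n + 1))"
      unfolding odd_prod_Suc by (simp only: ac_simps)
    moreover have "tri (2 * n + 1) = n * (2 * n + 1) + (2 * n + 1)"
      unfolding tri_double_Suc by simp
    ultimately show ?thesis by (simp only: power_add)
  qed
  have "(\<Sum>s\<le>Suc n. odd_prod x s * euler_prod x s (Suc n) * x ^ (s * (2 * Suc n + 1)))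
      = (\<Sum>s\<le>n. ?t s * ((1 - x ^ (2 * n + 2)) * x ^ (2 * s)))
        + odd_prod x (Suc n) * x ^ tri (2 * n + 2)"
  proof -
    have "odd_prod x s * euler_prod x s (Suc n) * x ^ (s * (2 * Suc n + 1))
        = ?t s * ((1 - x ^ (2 * n + 2)) * x ^ (2 * s))" if "s \<le> n" for s
    proof -
      have "s * (2 * Suc n + 1) = s * (2 * n + 1) + 2 * s" by simp
      then show ?thesis
        unfolding euler_prod_Suc_right[OF that] by (simp only: power_add ac_simps)
    qed
    then have "(\<Sum>s\<le>n. odd_prod x s * euler_prod x s (Suc n) * x ^ (s * (2 * Suc n + 1)))
        = (\<Sum>s\<le>n. ?t s * ((1 - x ^ (2 * n + 2)) * x ^ (2 * s)))"
      by (intro sum.cong refl) (simp only: atMost_iff)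
    moreover have "Suc n * (2 * Suc n + 1) = tri (2 * n + 2)"
      unfolding tri_double_Suc by (simp add: algebra_simps)
    ultimately show ?thesis
      by (simp only: sum.atMost_Suc euler_prod_same mult_1_right)
  qed
  also have "(\<Sum>s\<le>n. ?t s * ((1 - x ^ (2 * n + 2)) * x ^ (2 * s)))
      = (\<Sum>s\<le>n. ?t s * ?d s) + (\<Sum>s\<le>n. ?t s) * (1 - x ^ (2 * n + 1))"
    unfolding sum_distrib_right sum.distrib[symmetric]
    by (rule sum.cong) (simp_all add: algebra_simps)
  also have "\<dots> = odd_prod x (Suc n) * ((\<Sum>s\<le>2 * n. x ^ tri s) + x ^ tri (2 * n + 1))"
    unfolding diff Suc.IH odd_prod_Suc by (simp only: algebra_simps)
  finally show ?case
    by (simp add: algebra_simps)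
qed

text \<open>In Shanks's identity the term \<open>s = 0\<close> is \<open>euler_prod x 0 n\<close>,
  and every other term contains \<open>x ^ (2 * n + 1)\<close>. This is Gauss's product formula up
  to that order, with the denominator cleared.\<close>

lemma gauss_triangular:
  fixes x :: "'a::comm_ring_1"
  shows "x ^ (2 * n + 1) dvd euler_prod x 0 n - odd_prod x n * (\<Sum>s\<le>2 * n. x ^ tri s)"
proof -
  let ?f = "\<lambda>s. odd_prod x s * euler_prod x s n * x ^ (s * (2 * n + 1))"
  have "odd_prod x n * (\<Sum>s\<le>2 * n. x ^ tri s) = euler_prod x 0 n + (\<Sum>s\<in>{0<..n}. ?f s)"
  proof -
    have "{..n} = insert 0 {0<..n}" by auto
    then show ?thesis by (simp add: shanks_identity[symmetric] odd_prod_0)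
  qed
  moreover have "x ^ (2 * n + 1) dvd (\<Sum>s\<in>{0<..n}. ?f s)"
  proof (rule dvd_sum)
    fix s assume "s \<in> {0<..n}"
    then have "1 * (2 * n + 1) \<le> s * (2 * n + 1)" by (intro mult_right_mono) auto
    then have "x ^ (2 * n + 1) dvd x ^ (s * (2 * n + 1))"
      by (intro le_imp_power_dvd) simp
    then show "x ^ (2 * n + 1) dvd ?f s" by (rule dvd_mult)
  qed
  ultimately show ?thesis by simp
qed

section \<open>The generating function modulo 3\<close>

definition pod3_in :: "nat set \<Rightarrow> nat \<Rightarrow> nat multiset set" where
  "pod3_in A n = {P \<in> pod3_partitions n. set_mset P \<subseteq> A}"

text \<open>The coefficient ring is left open so that the series can later be read modulo 3.\<close>

definition pod3_gf :: "nat set \<Rightarrow> 'a::comm_ring_1 fps" where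
  "pod3_gf A = Abs_fps (\<lambda>n. of_nat (card (pod3_in A n)))"

lemma finite_pod3_in: "finite (pod3_in A n)"
  unfolding pod3_in_def by (rule finite_subset[OF _ finite_pod3_partitions]) auto

lemma pod3_gf_empty: "pod3_gf {} = 1"
proof -
  have "pod3_in {} n = (if n = 0 then {{#}} else {})" for n
    by (auto simp: pod3_in_def pod3_partitions_def)
  then show ?thesis by (auto simp: pod3_gf_def fps_eq_iff)
qed

text \<open>Split by whether \<open>a\<close> occurs. An odd \<open>a\<close> occurs only once, so
  the remaining parts lie in \<open>A\<close>. The guard \<open>a \<le> n\<close> keeps truncated
  subtraction from producing spurious partitions.\<close>

lemma pod3_in_insert_odd:
  assumes "odd a" "\<not> 3 dvd a" "a \<notin> A"
  shows "pod3_in (insert a A) n =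
    pod3_in A n \<union> add_mset a ` (if a \<le> n then pod3_in A (n - a) else {})"
proof (intro equalityI subsetI)
  fix P assume P: "P \<in> pod3_in (insert a A) n"
  show "P \<in> pod3_in A n \<union> add_mset a ` (if a \<le> n then pod3_in A (n - a) else {})"
  proof (cases "a \<in># P")
    case True
    then obtain Q where Q: "P = add_mset a Q" by (metis mset_add)
    have "count P a = 1" using P True assms by (auto simp: pod3_in_def pod3_partitions_def)
    then have aQ: "a \<notin># Q" by (simp add: Q not_in_iff)
    have "count Q x = 1" if "x \<in># Q" "odd x" for x
    proof -
      have "count P x = 1" using P Q that by (auto simp: pod3_in_def pod3_partitions_def)
      then show ?thesis using that aQ by (auto simp: Q split: if_splits)
    qed
    then have "a \<le> n \<and> Q \<in> pod3_in A (n - a)"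
      using P aQ by (auto simp: pod3_in_def pod3_partitions_def Q)
    then show ?thesis using Q by auto
  next
    case False
    then show ?thesis using P by (auto simp: pod3_in_def)
  qed
next
  fix P assume P: "P \<in> pod3_in A n \<union> add_mset a ` (if a \<le> n then pod3_in A (n - a) else {})"
  then consider "P \<in> pod3_in A n" | Q where "a \<le> n" "Q \<in> pod3_in A (n - a)" "P = add_mset a Q"
    by (auto split: if_splits)
  then show "P \<in> pod3_in (insert a A) n"
  proof cases
    case 1
    then show ?thesis by (auto simp: pod3_in_def)
  next
    case 2
    then have "a \<notin># Q" using assms by (auto simp: pod3_in_def)
    moreover have "a > 0" using assms by (auto intro: Nat.gr0I)
    ultimately show ?thesis
      using 2 assms by (auto simp: pod3_in_def pod3_partitions_def not_in_iff)
  qed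
qed

text \<open>An even part may repeat, so the rest may contain \<open>a\<close> again. The resulting
  recursion takes the place of a geometric series.\<close>

lemma pod3_in_insert_even:
  assumes "even a" "\<not> 3 dvd a" "a \<notin> A"
  shows "pod3_in (insert a A) n =
    pod3_in A n \<union> add_mset a ` (if a \<le> n then pod3_in (insert a A) (n - a) else {})"
proof (intro equalityI subsetI)
  fix P assume P: "P \<in> pod3_in (insert a A) n"
  show "P \<in> pod3_in A n \<union>
      add_mset a ` (if a \<le> n then pod3_in (insert a A) (n - a) else {})"
  proof (cases "a \<in># P")
    case True
    then obtain Q where Q: "P = add_mset a Q" by (metis mset_add)
    have "count Q x = 1" if "x \<in># Q" "odd x" for x
    proof -
      have "count P x = 1" using P Q that by (auto simp: pod3_in_def pod3_partitions_def)
      then show ?thesis using that assms by (auto simp: Q split: if_splits)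
    qed
    then have "a \<le> n \<and> Q \<in> pod3_in (insert a A) (n - a)"
      using P by (auto simp: pod3_in_def pod3_partitions_def Q)
    then show ?thesis using Q by auto
  next
    case False
    then show ?thesis using P by (auto simp: pod3_in_def)
  qed
next
  fix P assume P: "P \<in> pod3_in A n \<union>
      add_mset a ` (if a \<le> n then pod3_in (insert a A) (n - a) else {})"
  then consider "P \<in> pod3_in A n"
    | Q where "a \<le> n" "Q \<in> pod3_in (insert a A) (n - a)" "P = add_mset a Q"
    by (auto split: if_splits)
  then show "P \<in> pod3_in (insert a A) n"
  proof cases
    case 1
    then show ?thesis by (auto simp: pod3_in_def)
  next
    case 2
    moreover have "a > 0" using assms by (auto intro: Nat.gr0I)
    ultimately show ?thesis
      using assms by (auto simp: pod3_in_def pod3_partitions_def)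
  qed
qed

lemma card_Un_add_mset:
  assumes "a \<notin> A"
  shows "card (pod3_in A n \<union> add_mset a ` (if a \<le> n then pod3_in B (n - a) else {}))
    = card (pod3_in A n) + (if a \<le> n then card (pod3_in B (n - a)) else 0)"
proof -
  have "pod3_in A n \<inter> add_mset a ` (if a \<le> n then pod3_in B (n - a) else {}) = {}"
    using assms by (auto simp: pod3_in_def)
  then show ?thesis
    by (subst card_Un_disjoint) (auto simp: finite_pod3_in card_image inj_on_def)
qed

lemma pod3_gf_insert_odd:
  assumes "odd a" "\<not> 3 dvd a" "a \<notin> A"
  shows "pod3_gf (insert a A) = (1 + fps_X ^ a) * pod3_gf A"
  by (auto simp: fps_eq_iff pod3_gf_def pod3_in_insert_odd[OF assms] card_Un_add_mset[OF assms(3)]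
      distrib_right fps_X_power_mult_nth)

lemma pod3_gf_insert_even:
  assumes "even a" "\<not> 3 dvd a" "a \<notin> A"
  shows "(1 - fps_X ^ a) * pod3_gf (insert a A) = pod3_gf A"
proof -
  have "pod3_gf (insert a A) = pod3_gf A + fps_X ^ a * pod3_gf (insert a A)"
    unfolding fps_eq_iff
    by (subst pod3_gf_def)
      (auto simp: pod3_gf_def pod3_in_insert_even[OF assms, of "_::nat"] 
         card_Un_add_mset[OF assms(3)] fps_X_power_mult_nth)
  then show ?thesis by (simp add: algebra_simps)
qed

text \<open>The parts are inserted one at a time. Even parts belong to the denominator, which is
  multiplied out to avoid inverses.\<close>

lemma pod3_gf_prod:
  assumes "finite A" "\<forall>a\<in>A. \<not> 3 dvd a"
  shows "pod3_gf A * (\<Prod>a\<in>{a\<in>A. even a}. 1 - fps_X ^ a)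
    = (\<Prod>a\<in>{a\<in>A. odd a}. 1 + fps_X ^ a :: 'a::comm_ring_1 fps)"
  using assms
proof (induction A rule: finite_induct)
  case empty
  then show ?case by (simp add: pod3_gf_empty)
next
  case (insert a A)
  show ?case
  proof (cases "even a")
    case True
    then have "{b \<in> insert a A. even b} = insert a {b \<in> A. even b}"
      and "{b \<in> insert a A. odd b} = {b \<in> A. odd b}" by auto
    then show ?thesis
      using insert pod3_gf_insert_even[OF True, of A, where ?'a = 'a, symmetric]
      by (simp add: ac_simps)
  next
    case False
    then have "{b \<in> insert a A. odd b} = insert a {b \<in> A. odd b}"
      and "{b \<in> insert a A. even b} = {b \<in> A. even b}" by auto
    then show ?thesis
      using insert pod3_gf_insert_odd[OF False, of A, where ?'a = 'a] by (simp add: mult.assoc)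
  qed
qed

text \<open>A partition of \<open>n\<close> has no part above \<open>n\<close>, so the cutoff
  \<open>m\<close> does not affect this coefficient. The part 0 is excluded from the set because 3
  divides 0.\<close>

lemma pod3_gf_nth:
  assumes "n \<le> m"
  shows "fps_nth (pod3_gf {a\<in>{..m}. \<not> 3 dvd a}) n = of_nat (pod3 n)"
proof -
  have "set_mset P \<subseteq> {a\<in>{..m}. \<not> 3 dvd a}" if "P \<in> pod3_partitions n" for P
  proof -
    have "x \<le> n" if "x \<in># P" for x
      using \<open>P \<in> pod3_partitions n\<close> multi_member_split[OF that]
      by (auto simp: pod3_partitions_def)
    then show ?thesis using that assms by (fastforce simp: pod3_partitions_def)
  qed
  then have "pod3_in {a\<in>{..m}. \<not> 3 dvd a} n = pod3_partitions n"
    by (auto simp: pod3_in_def)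
  then show ?thesis by (simp add: pod3_gf_def pod3_def)
qed

section \<open>Truncated products in characteristic 3\<close>

lemma one_plus_cube:
  fixes y :: "'a::comm_ring_1"
  assumes "(3::'a) = 0"
  shows "(1 + y) ^ 3 = 1 + y ^ 3" "(1 - y) ^ 3 = 1 - y ^ 3"
proof -
  have "(1 + y) ^ 3 = 1 + y ^ 3 + 3 * (y + y ^ 2)"
    by (simp add: power3_eq_cube power2_eq_square algebra_simps)
  then show "(1 + y) ^ 3 = 1 + y ^ 3" using assms by simp
  have "(1 - y) ^ 3 = 1 - y ^ 3 + 3 * (y ^ 2 - y)"
    by (simp add: power3_eq_cube power2_eq_square algebra_simps)
  then show "(1 - y) ^ 3 = 1 - y ^ 3" using assms by simp
qed

text \<open>The sign change affects odd powers only. It turns the Gauss products into the numerator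
  (odd parts) and denominator (even parts) of a partition generating function that still includes
  multiples of 3.\<close>

lemma odd_prod_minus:
  fixes x :: "'a::comm_ring_1"
  shows "odd_prod (- x) n = (\<Prod>a\<in>{a\<in>{0<..2 * n}. odd a}. 1 + x ^ a)"
  unfolding odd_prod_def
  by (rule prod.reindex_bij_witness[of _ "\<lambda>a. (a + 1) div 2" "\<lambda>i. 2 * i - 1"])
    (auto elim!: oddE)

lemma euler_prod_minus:
  fixes x :: "'a::comm_ring_1"
  shows "euler_prod (- x) 0 n = (\<Prod>a\<in>{a\<in>{0<..2 * n}. even a}. 1 - x ^ a)"
  unfolding euler_prod_def
  by (rule prod.reindex_bij_witness[of _ "\<lambda>a. a div 2" "\<lambda>i. 2 * i"])
    (auto elim!: evenE)

lemma prod_split_multiples_3: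
  fixes f :: "nat \<Rightarrow> 'a::comm_monoid_mult"
  shows "(\<Prod>a\<in>{a\<in>{0<..6 * m}. Q a}. f a) =
    (\<Prod>a\<in>{a\<in>{a\<in>{..6 * m}. \<not> 3 dvd a}. Q a}. f a) *
    (\<Prod>a\<in>{a\<in>{0<..2 * m}. Q (3 * a)}. f (3 * a))"
proof -
  have "(\<Prod>a\<in>{a\<in>{0<..2 * m}. Q (3 * a)}. f (3 * a))
      = (\<Prod>a\<in>{a\<in>{0<..6 * m}. 3 dvd a \<and> Q a}. f a)"
    by (rule prod.reindex_bij_witness[of _ "\<lambda>a. a div 3" "\<lambda>i. 3 * i"]) auto
  moreover have "{a\<in>{0<..6 * m}. Q a} = {a\<in>{a\<in>{..6 * m}. \<not> 3 dvd a}. Q a} \<union>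
      {a\<in>{0<..6 * m}. 3 dvd a \<and> Q a}"
    by (auto intro: Nat.gr0I)
  ultimately show ?thesis
    by (simp only:) (rule prod.union_disjoint; auto)
qed

text \<open>In each product of length \<open>3 * m\<close>, the factors at multiples of 3 form the
  cube of the product of length \<open>m\<close>, since cubing is additive here. The other factors
  are those of the generating function. The cutoff \<open>6 * m\<close> makes this an exact identity
  of finite products.\<close>

lemma pod3_gf_mod_3:
  assumes "(3::'a::comm_ring_1 fps) = 0"
  defines "x \<equiv> - fps_X :: 'a fps"
  shows "pod3_gf {a\<in>{..6 * m}. \<not> 3 dvd a} * euler_prod x 0 (3 * m) * odd_prod x m ^ 3
    = odd_prod x (3 * m) * euler_prod x 0 m ^ 3"
proof -
  let ?A = "{a\<in>{..6 * m}. \<not> 3 dvd a}"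
  have O3: "odd_prod x m ^ 3 = (\<Prod>a\<in>{a\<in>{0<..2 * m}. odd (3 * a)}. 1 + fps_X ^ (3 * a))"
    unfolding x_def odd_prod_minus
    by (simp add: prod_power_distrib one_plus_cube[OF assms(1)]
        power_mult[symmetric] mult.commute)
  have E3: "euler_prod x 0 m ^ 3 = (\<Prod>a\<in>{a\<in>{0<..2 * m}. even (3 * a)}. 1 - fps_X ^ (3 * a))"
    unfolding x_def euler_prod_minus
    by (simp add: prod_power_distrib one_plus_cube[OF assms(1)]
        power_mult[symmetric] mult.commute)
  have O: "odd_prod x (3 * m) = (\<Prod>a\<in>{a\<in>?A. odd a}. 1 + fps_X ^ a) * odd_prod x m ^ 3"
    using prod_split_multiples_3[of "\<lambda>a. 1 + fps_X ^ a :: 'a fps" m odd]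
    unfolding O3 by (simp add: x_def odd_prod_minus)
  have E: "euler_prod x 0 (3 * m) =
      (\<Prod>a\<in>{a\<in>?A. even a}. 1 - fps_X ^ a) * euler_prod x 0 m ^ 3"
    using prod_split_multiples_3[of "\<lambda>a. 1 - fps_X ^ a :: 'a fps" m even]
    unfolding E3 by (simp add: x_def euler_prod_minus)
  have gf: "pod3_gf ?A * (\<Prod>a\<in>{a\<in>?A. even a}. 1 - fps_X ^ a)
      = (\<Prod>a\<in>{a\<in>?A. odd a}. 1 + fps_X ^ a :: 'a fps)"
    by (rule pod3_gf_prod) auto
  show ?thesis
    unfolding O E gf[symmetric] by (simp only: ac_simps)
qed

section \<open>Coefficients of the squared triangular series\<close>

definition tri_pairs :: "nat \<Rightarrow> (nat \<times> nat) set" where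
  "tri_pairs n = {(s, t). tri s + tri t = n}"

lemma fps_nth_square_triangular_sum:
  assumes "n \<le> m"
  shows "fps_nth ((\<Sum>s\<le>m. (- fps_X) ^ tri s) ^ 2) n
    = (-1) ^ n * (of_nat (card (tri_pairs n)) :: 'a::comm_ring_1)"
proof -
  have nth: "fps_nth ((- fps_X :: 'a fps) ^ k) n = (if n = k then (-1) ^ n else 0)" for k
  proof -
    have "(- fps_X :: 'a fps) ^ k = fps_const ((-1) ^ k) * fps_X ^ k"
      by (subst power_minus) (simp flip: fps_const_power fps_const_neg)
    then show ?thesis by simp
  qed
  \<comment> \<open>Since \<open>s \<le> tri s\<close>, truncating the series at \<open>m\<close>
    loses no pair contributing to the coefficient of index \<open>n\<close>.\<close>
  have "s \<le> m \<and> t \<le> m" if "tri s + tri t = n" for s t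
    using that assms tri_ge[of s] tri_ge[of t] by linarith
  then have eq: "{z \<in> {..m} \<times> {..m}. n = tri (fst z) + tri (snd z)} = tri_pairs n"
    by (auto simp: tri_pairs_def)
  have "((\<Sum>s\<le>m. (- fps_X :: 'a fps) ^ tri s) ^ 2)
      = (\<Sum>z\<in>{..m} \<times> {..m}. (- fps_X) ^ (tri (fst z) + tri (snd z)))"
    by (simp add: power2_eq_square sum_product sum.cartesian_product power_add case_prod_unfold)
  then have "fps_nth ((\<Sum>s\<le>m. (- fps_X :: 'a fps) ^ tri s) ^ 2) n
      = (\<Sum>z\<in>{..m} \<times> {..m}. if n = tri (fst z) + tri (snd z) then (-1) ^ n else 0)"
    by (simp add: fps_sum_nth nth)
  also have "\<dots> = (\<Sum>z\<in>tri_pairs n. (-1) ^ n)"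
    unfolding eq[symmetric] by (rule sum.inter_filter[symmetric]) simp
  finally show ?thesis by (simp add: mult.commute)
qed

section \<open>Congruences modulo a power of the variable\<close>

lemma fps_dvd_1:
  assumes "fps_nth f 0 = (1::'a::comm_ring_1)"
  shows "f dvd 1"
proof
  show "1 = f * fps_right_inverse f 1"
    by (rule fps_right_inverse[symmetric]) (simp add: assms)
qed

lemma dvd_mult_unit_cancel:
  fixes a b c :: "'a::comm_semiring_1"
  assumes "c dvd 1" "a dvd c * b"
  shows "a dvd b"
proof -
  obtain d where "1 = c * d" using assms(1) by (auto elim: dvdE)
  then have "b = d * (c * b)" by (metis mult.assoc mult.commute mult_1)
  then show ?thesis using assms(2) by (metis dvd_mult)
qed

lemma fps_X_power_dvd_nth_eq:
  assumes "fps_X ^ k dvd f - (g :: 'a::comm_ring_1 fps)" "n < k"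
  shows "fps_nth f n = fps_nth g n"
proof -
  obtain h where "f - g = fps_X ^ k * h" using assms(1) by (auto elim: dvdE)
  then have "fps_nth (f - g) n = 0" using assms(2) by (simp add: fps_X_power_mult_nth)
  then show ?thesis by simp
qed

lemma dvd_diff_mult:
  fixes d :: "'a::comm_ring_1"
  assumes "d dvd a - b" "d dvd a' - b'"
  shows "d dvd a * a' - b * b'"
proof -
  have "a * a' - b * b' = a * (a' - b') + (a - b) * b'" by (simp add: algebra_simps)
  then show ?thesis using assms by simp
qed

lemma dvd_diff_trans:
  fixes d :: "'a::comm_ring_1"
  assumes "d dvd a - b" "d dvd b - c"
  shows "d dvd a - c"
  using dvd_add[OF assms] by simp

lemma dvd_prod_minus_1:
  fixes d :: "'a::comm_ring_1"
  assumes "finite I" "\<And>i. i \<in> I \<Longrightarrow> d dvd f i - 1"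
  shows "d dvd prod f I - 1"
  using assms
proof (induction I rule: finite_induct)
  case (insert i I)
  then show ?case using dvd_diff_mult[of d "f i" 1 "prod f I" 1] by simp
qed simp

text \<open>The extra factors \<open>1 - x ^ (2 * i)\<close> with \<open>i > m\<close> are congruent
  to 1. The modulus is the one shared with \<open>odd_prod_cong\<close> and
  \<open>gauss_triangular\<close>.\<close>

lemma euler_prod_cong:
  fixes x :: "'a::comm_ring_1"
  assumes "m \<le> n"
  shows "x ^ (2 * m + 1) dvd euler_prod x 0 n - euler_prod x 0 m"
proof -
  have "{0<..n} = {0<..m} \<union> {m<..n}" using assms by auto
  then have eq: "euler_prod x 0 n = euler_prod x 0 m * euler_prod x m n"
    unfolding euler_prod_def by (simp only:) (rule prod.union_disjoint; auto)
  have "x ^ (2 * m + 1) dvd euler_prod x m n - 1"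
    unfolding euler_prod_def
    by (rule dvd_prod_minus_1) (auto intro!: le_imp_power_dvd simp del: power_Suc)
  then show ?thesis
    using dvd_mult[of _ _ "euler_prod x 0 m"] unfolding eq by (fastforce simp: right_diff_distrib)
qed

lemma odd_prod_cong:
  fixes x :: "'a::comm_ring_1"
  assumes "m \<le> n"
  shows "x ^ (2 * m + 1) dvd odd_prod x n - odd_prod x m"
proof -
  have "{0<..n} = {0<..m} \<union> {m<..n}" using assms by auto
  then have eq: "odd_prod x n = odd_prod x m * (\<Prod>i\<in>{m<..n}. 1 - x ^ (2 * i - 1))"
    unfolding odd_prod_def by (simp only:) (rule prod.union_disjoint; auto)
  have "x ^ (2 * m + 1) dvd (\<Prod>i\<in>{m<..n}. 1 - x ^ (2 * i - 1)) - 1"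
    by (rule dvd_prod_minus_1) (auto intro!: le_imp_power_dvd simp del: power_Suc)
  then show ?thesis
    using dvd_mult[of _ _ "odd_prod x m"] unfolding eq by (fastforce simp: right_diff_distrib)
qed

text \<open>Modulo \<open>d\<close>, Gauss gives \<open>E' \<equiv> E \<equiv> B * T\<close>, and
  \<open>B' \<equiv> B\<close>. The exact identity \<open>G * E' * B ^ 3 = B' * E ^ 3\<close>
  becomes \<open>G * (B * T) * B ^ 3 \<equiv> B * (B * T) ^ 3\<close>, and cancelling the unit
  \<open>B ^ 4 * T\<close> leaves \<open>T ^ 2\<close>.\<close>

lemma pod3_gf_cong_square:
  assumes "(3::'a::comm_ring_1 fps) = 0"
  defines "x \<equiv> - fps_X :: 'a fps"
  shows "fps_X ^ (2 * m + 1) dvd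
    pod3_gf {a\<in>{..6 * m}. \<not> 3 dvd a} - (\<Sum>s\<le>2 * m. x ^ tri s) ^ 2"
proof -
  define d where "d = x ^ (2 * m + 1)"
  define G where "G = (pod3_gf {a\<in>{..6 * m}. \<not> 3 dvd a} :: 'a fps)"
  define T where "T = (\<Sum>s\<le>2 * m. x ^ tri s)"
  define E B E' B' where "E = euler_prod x 0 m" and "B = odd_prod x m"
    and "E' = euler_prod x 0 (3 * m)" and "B' = odd_prod x (3 * m)"
  have EE': "d dvd E' - E" and BB': "d dvd B' - B"
    unfolding d_def E_def E'_def B_def B'_def by (rule euler_prod_cong odd_prod_cong; simp)+
  have EBT: "d dvd E - B * T"
    unfolding d_def E_def B_def T_def by (rule gauss_triangular)
  have GE: "G * E' * B ^ 3 = B' * E ^ 3"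
    using pod3_gf_mod_3[OF assms(1)] unfolding G_def E'_def B'_def E_def B_def x_def by simp
  have "d dvd G * (B * T) * B ^ 3 - G * E' * B ^ 3"
  proof -
    have "d dvd - (E' - B * T)" unfolding dvd_minus_iff by (rule dvd_diff_trans[OF EE' EBT])
    then have "d dvd (G * B ^ 3) * - (E' - B * T)" by (rule dvd_mult)
    then show ?thesis by (simp add: algebra_simps)
  qed
  moreover have "d dvd B' * E ^ 3 - B * (B * T) ^ 3"
    unfolding power3_eq_cube by (intro dvd_diff_mult BB' EBT)
  ultimately have "d dvd G * (B * T) * B ^ 3 - B * (B * T) ^ 3"
    unfolding GE by (rule dvd_diff_trans)
  then have "d dvd (B ^ 4 * T) * (G - T ^ 2)"
    by (simp add: algebra_simps power_numeral_reduce)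
  moreover have "(B ^ 4 * T) dvd 1"
  proof (rule fps_dvd_1)
    have x0: "fps_nth (x ^ k) 0 = (if k = 0 then 1 else 0)" for k
      by (auto simp: x_def fps_power_zeroth power_0_left)
    have "fps_nth B 0 = 1"
      unfolding B_def by (induction m) (auto simp: odd_prod_0 odd_prod_Suc x0 simp del: power_Suc)
    moreover have "fps_nth T 0 = 1"
    proof -
      have "tri s = 0 \<longleftrightarrow> s = 0" for s using tri_ge[of s] by (auto simp: tri_def)
      then show ?thesis unfolding T_def by (simp add: fps_sum_nth x0)
    qed
    ultimately show "fps_nth (B ^ 4 * T) 0 = 1" by (simp add: fps_power_zeroth)
  qed
  ultimately have "d dvd G - T ^ 2" by (rule dvd_mult_unit_cancel[rotated])
  \<comment> \<open>\<open>d\<close> is a power of \<open>- fps_X\<close>, so it differs from the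
    power of \<open>fps_X\<close> only by a sign.\<close>
  moreover have "fps_X ^ (2 * m + 1) dvd d"
    unfolding d_def x_def power_minus[of fps_X] by (rule dvd_triv_right)
  ultimately show ?thesis
    unfolding G_def T_def by (rule dvd_trans[rotated])
qed

text \<open>The type \<open>3\<close> is the ring of integers modulo 3. With truncation parameter
  \<open>n\<close>, the coefficient of index \<open>n\<close> lies below the order
  \<open>2 * n + 1\<close> of the congruence.\<close>

lemma pod3_cong_tri_pairs:
  "(of_nat (pod3 n) :: 3) = (-1) ^ n * of_nat (card (tri_pairs n))"
proof -
  have three: "(3 :: 3) = 0" by simp
  have "(3 :: 3 fps) = 0" unfolding numeral_fps_const three by simp
  from pod3_gf_cong_square[OF this, of n]
  have "fps_nth (pod3_gf {a\<in>{..6 * n}. \<not> 3 dvd a} :: 3 fps) n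
      = fps_nth ((\<Sum>s\<le>2 * n. (- fps_X) ^ tri s) ^ 2) n"
    by (rule fps_X_power_dvd_nth_eq) simp
  then show ?thesis
    by (subst (asm) pod3_gf_nth, simp, subst (asm) fps_nth_square_triangular_sum) simp_all
qed

section \<open>Sums of two odd squares\<close>

text \<open>Otherwise \<open>p\<close> divides neither number. Raising
  \<open>a ^ 2 \<equiv> - (b ^ 2)\<close> to the power (p-1)/2, which is odd and so keeps the sign,
  gives \<open>1 \<equiv> - 1\<close> by Fermat.\<close>

lemma prime_3_mod_4_dvd_sum_squares:
  fixes p a b :: nat
  assumes "prime p" "[p = 3] (mod 4)" "p dvd a ^ 2 + b ^ 2"
  shows "p dvd a"
proof (rule ccontr)
  assume a: "\<not> p dvd a"
  then have b: "\<not> p dvd b"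
    using assms by (metis dvd_add_left_iff pos2 prime_dvd_power_nat_iff)
  have "p mod 4 = 3" using assms(2) by (simp add: cong_def)
  then obtain k where "p = 4 * k + 3" by (metis mult_div_mod_eq)
  then have p1: "p - 1 = 2 * (2 * k + 1)" by simp
  have "[int a ^ 2 = - (int b ^ 2)] (mod int p)"
    using assms(3) by (simp add: cong_iff_dvd_diff flip: of_nat_power of_nat_add)
  then have "[(int a ^ 2) ^ (2 * k + 1) = (- (int b ^ 2)) ^ (2 * k + 1)] (mod int p)"
    by (rule cong_pow)
  then have "[int a ^ (p - 1) = - (int b ^ (p - 1))] (mod int p)"
    unfolding p1 power_mult by simp
  moreover have "[int a ^ (p - 1) = 1] (mod int p)" "[int b ^ (p - 1) = 1] (mod int p)"
    using fermat_theorem[OF assms(1) a] fermat_theorem[OF assms(1) b]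
    by (metis cong_int_iff of_nat_1 of_nat_power)+
  ultimately have "[1 = - 1] (mod int p)"
    by (meson cong_minus_minus_iff cong_sym cong_trans)
  then have "int p dvd 2" by (simp add: cong_iff_dvd_diff)
  then have "p \<le> 2" by (metis dvd_imp_le int_dvd_int_iff of_nat_numeral pos2)
  then show False using \<open>p = 4 * k + 3\<close> by simp
qed

text \<open>Completing the square: \<open>8 * tri s + 1 = (2 * s + 1) ^ 2\<close>.\<close>

lemma tri_pairs_iff:
  "(s, t) \<in> tri_pairs n \<longleftrightarrow> (2 * s + 1) ^ 2 + (2 * t + 1) ^ 2 = 2 * (4 * n + 1)"
proof -
  have "(2 * s + 1) ^ 2 = 8 * tri s + 1" for s
    using two_tri[of s] by (simp add: power2_eq_square algebra_simps)
  then show ?thesis by (auto simp: tri_pairs_def)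
qed

text \<open>Multiplying both odd numbers by \<open>p\<close> is a bijection between the two sets of
  representations; it is onto because \<open>p\<close> must divide both of them.\<close>

lemma card_tri_pairs_prime_square:
  fixes p :: nat
  assumes "prime p" "[p = 3] (mod 4)" "4 * n + 1 = p ^ 2 * (4 * n' + 1)"
  shows "card (tri_pairs n) = card (tri_pairs n')"
proof -
  have "odd p" using assms(2) by (auto simp: cong_def) presburger
  \<comment> \<open>This is multiplication by \<open>p\<close> in the coordinate
    \<open>2 * s + 1\<close>.\<close>
  define f where "f s = p * s + (p - 1) div 2" for s
  have f: "2 * f s + 1 = p * (2 * s + 1)" for s
    using \<open>odd p\<close> by (auto simp: f_def elim!: oddE)
  have "p > 0" using assms(1) by (rule prime_gt_0_nat)
  have surj: "\<exists>u. s = f u" if "p dvd 2 * s + 1" for s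
  proof -
    obtain k where k: "2 * s + 1 = p * k" using \<open>p dvd 2 * s + 1\<close> by (auto elim: dvdE)
    then have "odd (p * k)" by presburger
    then have "odd k" by simp
    then obtain u where "k = 2 * u + 1" by (auto elim: oddE)
    then have "s = f u" using k f[of u] by simp
    then show ?thesis ..
  qed
  have iff: "(f s, f t) \<in> tri_pairs n \<longleftrightarrow> (s, t) \<in> tri_pairs n'" for s t
  proof -
    have "(2 * f s + 1) ^ 2 + (2 * f t + 1) ^ 2 = p ^ 2 * ((2 * s + 1) ^ 2 + (2 * t + 1) ^ 2)"
      unfolding f power_mult_distrib by (rule distrib_left[symmetric])
    moreover have "2 * (4 * n + 1) = p ^ 2 * (2 * (4 * n' + 1))" using assms(3) by simp
    moreover have "p ^ 2 \<noteq> 0" using \<open>p > 0\<close> by simp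
    ultimately show ?thesis
      unfolding tri_pairs_iff by (simp only: mult_cancel1) simp
  qed
  have "tri_pairs n = map_prod f f ` tri_pairs n'"
  proof (intro equalityI subsetI)
    fix z assume z: "z \<in> tri_pairs n"
    obtain s t where st: "z = (s, t)" by (cases z)
    have "p dvd 2 * (4 * n + 1)" unfolding assms(3) by (simp add: power2_eq_square)
    then have sq: "p dvd (2 * s + 1) ^ 2 + (2 * t + 1) ^ 2"
      using z unfolding st tri_pairs_iff by metis
    have "p dvd 2 * s + 1" "p dvd 2 * t + 1"
      using prime_3_mod_4_dvd_sum_squares[OF assms(1,2)] sq by (metis add.commute)+
    then obtain u v where "s = f u" "t = f v" using surj by blast
    then show "z \<in> map_prod f f ` tri_pairs n'"
      using z iff[of u v] unfolding st by force
  qed (auto simp: iff)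
  moreover have "inj f" using f \<open>p > 0\<close> by (intro injI) (simp add: f_def)
  then have "inj (map_prod f f)" by (intro prod.inj_map)
  ultimately show ?thesis by (simp add: card_image inj_on_subset)
qed

theorem theorem2:
  fixes k p \<delta> :: nat
  assumes "k \<ge> 1" and "prime p" and "[p = 3] (mod 4)" and "p dvd 4 * \<delta> + 3"
  shows "\<forall>n::nat. [pod3 (p ^ (k + 1) * n + p * \<delta> + (3 * p - 1) div 4)
                 = pod3 (p ^ (k - 1) * n + (4 * \<delta> + 3 - p) div (4 * p))] (mod 3)"
proof
  fix n :: nat
  define N where "N = p ^ (k + 1) * n + p * \<delta> + (3 * p - 1) div 4"
  define N' where "N' = p ^ (k - 1) * n + (4 * \<delta> + 3 - p) div (4 * p)"
  have "p mod 4 = 3" using assms(3) by (simp add: cong_def)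
  then obtain r where r: "p = 4 * r + 3" by (metis mult_div_mod_eq)
  obtain c where c: "4 * \<delta> + 3 = p * c" using assms(4) by (auto elim: dvdE)
  have "(p * c) mod 4 = 3" unfolding c[symmetric] by presburger
  \<comment> \<open>As \<open>p\<close> is 3 modulo 4, so is \<open>3 * c\<close>; this makes
    \<open>c\<close> congruent to 1 and the quotient (c-1)/4 integral.\<close>
  then have "(3 * c) mod 4 = 3"
    using mod_mult_left_eq[of p 4 c] unfolding \<open>p mod 4 = 3\<close> by argo
  then have "c mod 4 = 1" by presburger
  then obtain e where e: "c = 4 * e + 1" by (metis mult_div_mod_eq)
  have "(4 * \<delta> + 3 - p) div (4 * p) = e"
  proof -
    have "p * (4 * e + 1) - p = 4 * p * e" by (simp add: distrib_left)
    moreover have "4 * p > 0" using r by simp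
    ultimately show ?thesis unfolding c e by (metis div_mult_self1_is_m)
  qed
  then have N': "4 * N' + 1 = 4 * (p ^ (k - 1) * n) + c" by (simp add: N'_def e)
  \<comment> \<open>The division is exact: \<open>3 * p - 1\<close> is
    \<open>12 * r + 8\<close>.\<close>
  have "4 * ((3 * p - 1) div 4) + 1 = 3 * p" unfolding r by simp
  then have "4 * N + 1 = 4 * (p ^ (k + 1) * n) + p * (4 * \<delta> + 3)"
    unfolding N_def by (simp add: algebra_simps)
  also have "p ^ (k + 1) = p ^ 2 * p ^ (k - 1)"
    using assms(1) by (simp flip: power_add)
  also have "4 * (p ^ 2 * p ^ (k - 1) * n) + p * (4 * \<delta> + 3) = p ^ 2 * (4 * N' + 1)"
    unfolding N' c by (simp add: algebra_simps power2_eq_square)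
  finally have N: "4 * N + 1 = p ^ 2 * (4 * N' + 1)" .
  have "even N \<longleftrightarrow> even N'"
  proof -
    \<comment> \<open>The square of \<open>p\<close> is 1 modulo 8, so \<open>4 * N\<close> and
      \<open>4 * N'\<close> agree modulo 8. This gives equal parity and hence equal signs.\<close>
    have "p ^ 2 = 8 * (2 * r ^ 2 + 3 * r + 1) + 1"
      unfolding r by (simp add: power2_eq_square algebra_simps)
    then have "4 * N = 4 * N' + 8 * ((2 * r ^ 2 + 3 * r + 1) * (4 * N' + 1))"
      using N by (simp add: algebra_simps)
    then have "N = N' + 2 * ((2 * r ^ 2 + 3 * r + 1) * (4 * N' + 1))" by simp
    then show ?thesis by (metis even_add dvd_triv_left)
  qed
  then have "(-1 :: 3) ^ N = (-1) ^ N'" by (simp add: minus_one_power_iff)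
  then have "(of_nat (pod3 N) :: 3) = of_nat (pod3 N')"
    unfolding pod3_cong_tri_pairs card_tri_pairs_prime_square[OF assms(2,3) N] by simp
  then have "[pod3 N = pod3 N'] (mod 3)"
    by (simp add: of_nat_eq_iff_cong_CHAR)
  then show "[pod3 (p ^ (k + 1) * n + p * \<delta> + (3 * p - 1) div 4)
      = pod3 (p ^ (k - 1) * n + (4 * \<delta> + 3 - p) div (4 * p))] (mod 3)"
    unfolding N_def N'_def .
qed

end
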